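(* Let $1<p<\infty$ and $0<s<1$. For $\beta\in\left(-\frac{1}{p-1},\frac{s\,p}{p-1}\right)$ let \[ \lambda(\beta)=2\int_0^1\frac{J_p(1-t^\beta)}{(1-t)^{1+s\,p}}\left(1-t^{s\,p-1-\beta(p-1)}\right)dt+\frac{2}{s\,p}. \] Then the function $\beta\mapsto\lambda(\beta)$ has the following properties: (1) it is monotonically decreasing for $\beta>(s\,p-1)/p$ and monotonically increasing for $\beta<(s\,p-1)/p$. In particular, \[ \lambda(\beta)\le\lambda\left(\frac{s\,p-1}{p}\right)=2\int_0^1\frac{\left|1-t^{\frac{s\,p-1}{p}}\right|^p}{(1-t)^{1+s\,p}}\,dt+\frac{2}{s\,p}; \] (2) there exists $\beta^*=\beta^*(s,p)$ such that \[ -\frac1{p-1}<\beta^*<\frac{s\,p-1}{p}\qquad\text{and}\qquad\lambda(\beta^* )=\lambda(s)=0. \] In particular, $\lambda(\beta)\ge0$ if and only if $\beta^*\le\beta\le s$.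
   Context: $J_p(t)=|t|^{p-2}t$ for $t\in\mathbb{R}$. *)

theory Defs
  imports "HOL-Analysis.Analysis"
begin

definition J :: "real \<Rightarrow> real \<Rightarrow> real" where
  "J p t = \<bar>t\<bar> powr (p - 2) * t"

(* For 1 < p, 0 < s < 1 and - 1 / (p - 1) < \<beta> < s * p / (p - 1) the integrand is absolutely
   integrable; outside this range of \<beta> the value carries no meaning. On the open interval every
   base of a real power is positive, except the inner |1 - t powr \<beta>| in J when \<beta> = 0,
   and then J p 0 = 0 because of the factor t in J. *)
definition lambda :: "real \<Rightarrow> real \<Rightarrow> real \<Rightarrow> real" where
  "lambda s p \<beta> =
     2 * (LINT t:{0<..<1}|lborel.
            J p (1 - t powr \<beta>) / (1 - t) powr (1 + s * p)
              * (1 - t powr (s * p - 1 - \<beta> * (p - 1))))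
     + 2 / (s * p)"

end

theory Submission
  imports Defs
begin

text \<open>
  Fix \<open>t\<close> in \<open>(0, 1)\<close>. Substituting \<open>a = t powr \<beta>\<close> and \<open>c = t powr (s * p - 1)\<close> turns the numerator
  of the integrand into \<open>J p (1 - a) * (1 - c * a powr (1 - p))\<close>, in which \<open>\<beta>\<close> enters through \<open>a\<close>
  alone. When this is differentiated in \<open>a\<close>, the terms without a definite sign cancel and
  \<open>(p - 1) * \<bar>1 - a\<bar> powr (p - 2) * (c * a powr (- p) - 1)\<close> is left. Its sign is that of
  \<open>c - a powr p\<close>, and \<open>a powr p\<close> equals \<open>c\<close> precisely for \<open>\<beta> = (s * p - 1) / p\<close>, whatever \<open>t\<close> is.
  So the integrand itself is unimodal in \<open>\<beta>\<close> with a peak that does not depend on \<open>t\<close>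
  (\<open>lambda_integrand_strict_mono\<close>, \<open>lambda_integrand_strict_antimono\<close>). It is integrable for the
  admissible \<open>\<beta>\<close> (\<open>lambda_integrand_integrable\<close>), and strict inequalities survive integration; this
  is the monotonicity claim. At the peak the two factors of the integrand have the same argument,
  and \<open>J p x * x = \<bar>x\<bar> powr p\<close> gives the formula for the maximum.

  That \<open>\<beta> = s\<close> is a zero is an exact integration: the integrand is then \<open>1 / (s * p)\<close> times the
  derivative of \<open>(1 - t powr s) powr p * (1 - t) powr (- s * p)\<close>, which falls from \<open>1\<close> to \<open>0\<close>
  (\<open>lambda_s_eq_0\<close>). Since \<open>s\<close> lies to the right of the peak, the maximum is positive. To the left,
  \<open>lambda\<close> is continuous (\<open>continuous_on_lambda\<close>) and becomes negative near \<open>- 1 / (p - 1)\<close>, because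
  there the integrand behaves like \<open>- (t powr (\<beta> * (p - 1)))\<close> at \<open>t = 0\<close> and its integral diverges
  (\<open>lambda_negative_near_left_end\<close>). The intermediate value theorem supplies \<open>\<beta>'\<close>, and
  unimodality determines the sign of \<open>lambda\<close> everywhere.
\<close>

section \<open>The odd power function\<close>

lemma J_eq_sgn: "J p x = sgn x * \<bar>x\<bar> powr (p - 1)"
proof (cases "x = 0")
  case False
  have "\<bar>x\<bar> powr (p - 1) = \<bar>x\<bar> powr (p - 2) * \<bar>x\<bar>"
    using False powr_add[of "\<bar>x\<bar>" "p - 2" 1] by simp
  then show ?thesis
    by (simp add: J_def sgn_if)
qed (simp add: J_def)

lemma abs_J: "1 < p \<Longrightarrow> \<bar>J p x\<bar> = \<bar>x\<bar> powr (p - 1)"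
  by (simp add: J_eq_sgn abs_mult abs_sgn_eq)

lemma J_mult_self: "J p x * x = \<bar>x\<bar> powr p"
proof (cases "x = 0")
  case False
  have "\<bar>x\<bar> powr p = \<bar>x\<bar> powr (p - 2) * (\<bar>x\<bar> * \<bar>x\<bar>)"
    using False powr_add[of "\<bar>x\<bar>" "p - 2" 2] by (simp add: powr_realpow power2_eq_square)
  then show ?thesis
    by (simp add: J_def)
qed (simp add: J_def)

text \<open>Unlike the defining formula, both terms are manifestly continuous at \<open>0\<close> also for \<open>p < 2\<close>.\<close>

lemma J_eq_max: "1 < p \<Longrightarrow> J p x = max x 0 powr (p - 1) - max (- x) 0 powr (p - 1)"
  by (simp add: J_eq_sgn sgn_if max_def)

lemma continuous_on_J [continuous_intros]:
  assumes "1 < p" and "continuous_on A f"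
  shows "continuous_on A (\<lambda>x. J p (f x))"
  unfolding J_eq_max[OF assms(1)]
  using assms by (intro continuous_intros continuous_on_powr') auto

lemma J_has_real_derivative:
  assumes "x \<noteq> 0"
  shows "(J p has_real_derivative (p - 1) * \<bar>x\<bar> powr (p - 2)) (at x)"
proof (cases "x > 0")
  case True
  have "((\<lambda>x. x powr (p - 1)) has_real_derivative (p - 1) * \<bar>x\<bar> powr (p - 2)) (at x)"
    using True by (auto intro!: derivative_eq_intros)
  then show ?thesis
    by (rule has_field_derivative_transform_within_open[where S = "{0<..}"])
      (use True in \<open>auto simp: J_eq_sgn\<close>)
next
  case False
  with assms have "x < 0" by simp
  then have "((\<lambda>x. - ((- x) powr (p - 1))) has_real_derivative (p - 1) * \<bar>x\<bar> powr (p - 2)) (at x)"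
    by (auto intro!: derivative_eq_intros)
  then show ?thesis
    by (rule has_field_derivative_transform_within_open[where S = "{..<0}"])
      (use \<open>x < 0\<close> in \<open>auto simp: J_eq_sgn\<close>)
qed

section \<open>Unimodality of the integrand in the parameter\<close>

text \<open>For \<open>p < 2\<close> the derivative of \<open>J p (1 - a)\<close> blows up at \<open>a = 1\<close>; a continuous function does not
  lose its strict monotonicity through one such point.\<close>

lemma DERIV_pos_except_point_imp_increasing:
  fixes f :: "real \<Rightarrow> real"
  assumes "a < b" and cont: "continuous_on {a..b} f"
    and deriv: "\<And>x. a < x \<Longrightarrow> x < b \<Longrightarrow> x \<noteq> z \<Longrightarrow> \<exists>y. DERIV f x :> y \<and> y > 0"
  shows "f a < f b"
proof (cases "a < z \<and> z < b")
  case True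
  have "f a < f z"
    by (rule DERIV_pos_imp_increasing_open)
      (use True deriv in \<open>auto intro: continuous_on_subset[OF cont]\<close>)
  moreover have "f z < f b"
    by (rule DERIV_pos_imp_increasing_open)
      (use True deriv in \<open>auto intro: continuous_on_subset[OF cont]\<close>)
  ultimately show ?thesis by simp
next
  case False
  show ?thesis
    by (rule DERIV_pos_imp_increasing_open) (use assms False in auto)
qed

text \<open>The numerator of the integrand, seen as a function of \<open>a = t powr \<beta>\<close> for \<open>c = t powr (s * p - 1)\<close>.\<close>

definition profile :: "real \<Rightarrow> real \<Rightarrow> real \<Rightarrow> real" where
  "profile p c a = J p (1 - a) * (1 - c * a powr (1 - p))"

text \<open>The product rule gives \<open>(p - 1) * \<bar>1 - a\<bar> powr (p - 2)\<close> times
  \<open>- (1 - c * a powr (1 - p)) + (1 - a) * c * a powr (- p)\<close>, where the terms with \<open>a powr (1 - p)\<close>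
  cancel.\<close>

lemma profile_has_real_derivative:
  assumes "0 < a" and "a \<noteq> 1"
  shows "(profile p c has_real_derivative
    (p - 1) * \<bar>1 - a\<bar> powr (p - 2) * (c * a powr (- p) - 1)) (at a)"
proof -
  have "((\<lambda>a. J p (1 - a)) has_real_derivative (p - 1) * \<bar>1 - a\<bar> powr (p - 2) * (- 1)) (at a)"
    by (rule DERIV_chain2[OF J_has_real_derivative]) (use assms in \<open>auto intro!: derivative_eq_intros\<close>)
  moreover have "((\<lambda>a. 1 - c * a powr (1 - p)) has_real_derivative
      - (c * ((1 - p) * a powr (- p)))) (at a)"
    using assms by (auto intro!: derivative_eq_intros)
  ultimately have "((\<lambda>a. J p (1 - a) * (1 - c * a powr (1 - p))) has_real_derivative
      (p - 1) * \<bar>1 - a\<bar> powr (p - 2) * (- 1) * (1 - c * a powr (1 - p))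
      + - (c * ((1 - p) * a powr (- p))) * J p (1 - a)) (at a)"
    by (rule DERIV_mult)
  moreover have "a powr (1 - p) = a * a powr (- p)"
    using assms powr_add[of a 1 "- p"] by simp
  ultimately show ?thesis
    unfolding profile_def[abs_def] J_def by (simp add: algebra_simps)
qed

lemma continuous_on_profile:
  assumes "1 < p" and "0 < a"
  shows "continuous_on {a..b} (profile p c)"
  unfolding profile_def[abs_def] using assms by (auto intro!: continuous_intros)

lemma profile_increasing:
  assumes "1 < p" and "0 < a" and "a < b" and "b powr p \<le> c"
  shows "profile p c a < profile p c b"
proof (rule DERIV_pos_except_point_imp_increasing[where f = "profile p c" and z = 1])
  fix x assume x: "a < x" "x < b" "x \<noteq> 1"
  have "x powr p < c"
    using powr_less_mono2[of p x b] x assms by simp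
  then have "0 < c * x powr (- p) - 1"
    using x assms by (simp add: powr_minus field_simps)
  then show "\<exists>y. DERIV (profile p c) x :> y \<and> y > 0"
    using profile_has_real_derivative[of x p c] x assms by (intro exI[of _ "(p - 1) * \<bar>1 - x\<bar> powr (p - 2) * (c * x powr (- p) - 1)"] conjI) auto
qed (use assms continuous_on_profile in auto)

lemma profile_decreasing:
  assumes "1 < p" and "0 < a" and "a < b" and "c \<le> a powr p"
  shows "profile p c b < profile p c a"
proof -
  have "- profile p c a < - profile p c b"
  proof (rule DERIV_pos_except_point_imp_increasing[where f = "\<lambda>x. - profile p c x" and z = 1])
    fix x assume x: "a < x" "x < b" "x \<noteq> 1"
    have "c < x powr p"
      using powr_less_mono2[of p a x] x assms by simp
    then have "(p - 1) * \<bar>1 - x\<bar> powr (p - 2) * (c * x powr (- p) - 1) < 0"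
      using x assms by (intro mult_pos_neg) (auto simp: powr_minus field_simps)
    moreover have "DERIV (\<lambda>x. - profile p c x) x :>
        - ((p - 1) * \<bar>1 - x\<bar> powr (p - 2) * (c * x powr (- p) - 1))"
      using x assms by (intro DERIV_minus profile_has_real_derivative) auto
    ultimately show "\<exists>y. DERIV (\<lambda>x. - profile p c x) x :> y \<and> y > 0"
      by (metis neg_0_less_iff_less)
  qed (use assms continuous_on_profile in \<open>auto intro!: continuous_intros\<close>)
  then show ?thesis by simp
qed

text \<open>The integrand depends on \<open>s\<close> only through \<open>r = s * p\<close>.\<close>

definition lambda_integrand :: "real \<Rightarrow> real \<Rightarrow> real \<Rightarrow> real \<Rightarrow> real" where
  "lambda_integrand p r \<beta> t =
     J p (1 - t powr \<beta>) / (1 - t) powr (1 + r) * (1 - t powr (r - 1 - \<beta> * (p - 1)))"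

lemma lambda_eq:
  "lambda s p \<beta> = 2 * (LINT t:{0<..<1}|lborel. lambda_integrand p (s * p) \<beta> t) + 2 / (s * p)"
  by (simp add: lambda_def lambda_integrand_def)

lemma lambda_integrand_eq_profile:
  assumes "0 < t"
  shows "lambda_integrand p r \<beta> t
    = profile p (t powr (r - 1)) (t powr \<beta>) / (1 - t) powr (1 + r)"
proof -
  have "t powr (r - 1) * (t powr \<beta>) powr (1 - p) = t powr (r - 1 - \<beta> * (p - 1))"
    by (simp add: powr_powr algebra_simps flip: powr_add)
  then show ?thesis by (simp add: lambda_integrand_def profile_def)
qed

text \<open>As \<open>t < 1\<close>, a larger parameter means a smaller \<open>a = t powr \<beta>\<close>, and \<open>\<gamma> \<le> (r - 1) / p\<close> means that
  both values of \<open>a\<close> lie where the profile decreases.\<close>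

lemma lambda_integrand_strict_mono:
  assumes "1 < p" and "0 < t" and "t < 1" and "\<beta> < \<gamma>" and "\<gamma> \<le> (r - 1) / p"
  shows "lambda_integrand p r \<beta> t < lambda_integrand p r \<gamma> t"
proof -
  have "profile p (t powr (r - 1)) (t powr \<beta>) < profile p (t powr (r - 1)) (t powr \<gamma>)"
    using assms
    by (intro profile_decreasing) (auto simp: powr_powr field_simps intro!: powr_mono' powr_less_mono')
  then show ?thesis
    using assms by (simp add: lambda_integrand_eq_profile divide_strict_right_mono)
qed

lemma lambda_integrand_strict_antimono:
  assumes "1 < p" and "0 < t" and "t < 1" and "\<beta> < \<gamma>" and "(r - 1) / p \<le> \<beta>"
  shows "lambda_integrand p r \<gamma> t < lambda_integrand p r \<beta> t"
proof -
  have "profile p (t powr (r - 1)) (t powr \<gamma>) < profile p (t powr (r - 1)) (t powr \<beta>)"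
    using assms
    by (intro profile_increasing) (auto simp: powr_powr field_simps intro!: powr_mono' powr_less_mono')
  then show ?thesis
    using assms by (simp add: lambda_integrand_eq_profile divide_strict_right_mono)
qed

section \<open>Integrability\<close>

lemma continuous_on_lambda_integrand_parameter:
  assumes "1 < p" and "0 < t" and "t < 1"
  shows "continuous_on A (\<lambda>\<beta>. lambda_integrand p r \<beta> t)"
  unfolding lambda_integrand_def using assms
  by (intro continuous_intros) auto

lemma continuous_on_lambda_integrand:
  assumes "1 < p"
  shows "continuous_on {0<..<1} (lambda_integrand p r \<beta>)"
  unfolding lambda_integrand_def[abs_def] using assms
  by (intro continuous_intros) auto

text \<open>One estimate for both ends of the interval: the factor \<open>1 - t\<close> is the linear vanishing at \<open>t = 1\<close>,
  and \<open>1 + t powr \<beta>\<close> takes care of the possible blow-up at \<open>t = 0\<close>.\<close>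

lemma abs_one_minus_powr_le:
  assumes "0 < t" and "t < (1::real)"
  shows "\<bar>1 - t powr \<beta>\<bar> \<le> 2 * (1 + \<bar>\<beta>\<bar>) * ((1 - t) * (1 + t powr \<beta>))"
proof (cases "t \<le> 1/2")
  case True
  have "\<bar>1 - t powr \<beta>\<bar> \<le> 1 * (1 + t powr \<beta>)"
    by (simp add: abs_le_iff)
  also have "\<dots> \<le> (2 * (1 - t)) * (1 + t powr \<beta>)"
    using True powr_ge_zero[of t \<beta>] by (intro mult_right_mono) auto
  also have "\<dots> \<le> (1 + \<bar>\<beta>\<bar>) * ((2 * (1 - t)) * (1 + t powr \<beta>))"
    using assms
      mult_right_mono[of 1 "1 + \<bar>\<beta>\<bar>" "(2 * (1 - t)) * (1 + t powr \<beta>)"] by simp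
  finally show ?thesis by (simp add: algebra_simps)
next
  case False
  \<comment> \<open>Away from \<open>0\<close> the claim follows from \<open>\<bar>exp y - 1\<bar> \<le> \<bar>y\<bar> * max 1 (exp y)\<close> and
    \<open>\<bar>ln t\<bar> \<le> 1 / t - 1\<close>.\<close>
  define y where "y = \<beta> * ln t"
  have "t powr \<beta> = exp y" using assms by (simp add: powr_def y_def)
  have "- ln t = ln (1 / t)" using assms by (simp add: ln_div)
  also have "\<dots> \<le> 1 / t - 1" using assms by (intro ln_le_minus_one) auto
  also have "\<dots> \<le> 2 * (1 - t)"
  proof -
    have "(1 - t) * (1 / t) \<le> (1 - t) * 2"
      using assms False by (intro mult_left_mono) (auto simp: field_simps)
    then show ?thesis using assms by (simp add: field_simps)
  qed
  finally have "\<bar>ln t\<bar> \<le> 2 * (1 - t)" using assms by (simp add: abs_if)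
  then have y: "\<bar>y\<bar> \<le> \<bar>\<beta>\<bar> * (2 * (1 - t))"
    unfolding y_def abs_mult by (rule mult_left_mono) simp
  have "exp y - 1 \<le> \<bar>y\<bar> * exp y"
  proof -
    have "1 - y \<le> exp (- y)" using exp_ge_add_one_self[of "- y"] by simp
    then have "exp y * (1 - y) \<le> exp y * exp (- y)" by (intro mult_left_mono) auto
    then have "exp y - 1 \<le> y * exp y" by (simp add: exp_minus algebra_simps)
    also have "\<dots> \<le> \<bar>y\<bar> * exp y" by (intro mult_right_mono) auto
    finally show ?thesis .
  qed
  moreover have "1 - exp y \<le> \<bar>y\<bar>" using exp_ge_add_one_self[of y] by linarith
  moreover have "0 \<le> \<bar>y\<bar> * exp y" by simp
  ultimately have "\<bar>1 - exp y\<bar> \<le> \<bar>y\<bar> + \<bar>y\<bar> * exp y" by linarith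
  also have "\<dots> = \<bar>y\<bar> * (1 + exp y)" by (simp add: algebra_simps)
  also have "\<dots> \<le> (1 + \<bar>\<beta>\<bar>) * (2 * (1 - t)) * (1 + exp y)"
    using y assms by (intro mult_right_mono) (auto simp: algebra_simps intro: add_pos_pos less_imp_le)
  finally show ?thesis using \<open>t powr \<beta> = exp y\<close> by (simp add: algebra_simps)
qed


lemma powr_one_plus_le:
  assumes "0 < q" and "0 \<le> (a::real)"
  shows "(1 + a) powr q \<le> 2 powr q * (1 + a powr q)"
proof -
  have "(1 + a) powr q \<le> (2 * max 1 a) powr q"
    using assms by (intro powr_mono2) auto
  also have "\<dots> = 2 powr q * max 1 a powr q"
    using assms by (intro powr_mult)
  also have "\<dots> \<le> 2 powr q * (1 + a powr q)"
    using assms by (intro mult_left_mono) (auto simp: max_def)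
  finally show ?thesis .
qed

text \<open>Estimating both differences by \<open>abs_one_minus_powr_le\<close> yields a sum of four Beta integrands with the common factor
  \<open>(1 - t) powr (p - r - 1)\<close>. The powers of \<open>t\<close> are \<open>0\<close>, \<open>\<beta> * (p - 1)\<close>, \<open>r - 1 - \<beta> * (p - 1)\<close> and
  \<open>r - 1\<close>, and the two bounds on \<open>\<beta>\<close> say that the middle two exceed \<open>- 1\<close>.\<close>

lemma lambda_integrand_integrable:
  assumes "1 < p" and "0 < r" and "r < p" and "- 1 < \<beta> * (p - 1)" and "\<beta> * (p - 1) < r"
  shows "set_integrable lborel {0<..<1} (lambda_integrand p r \<beta>)"
proof -
  define \<gamma> where "\<gamma> = r - 1 - \<beta> * (p - 1)"
  define K where "K = (2 * (1 + \<bar>\<beta>\<bar>)) powr (p - 1) * 2 powr (p - 1) * (2 * (1 + \<bar>\<gamma>\<bar>))"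
  define h where "h t = K * (t powr (1 - 1) * (1 - t) powr (p - r - 1)
      + t powr (\<beta> * (p - 1) + 1 - 1) * (1 - t) powr (p - r - 1)
      + t powr (\<gamma> + 1 - 1) * (1 - t) powr (p - r - 1)
      + t powr (r - 1) * (1 - t) powr (p - r - 1))" for t :: real
  have "set_integrable lborel {0..1} h"
    unfolding h_def using assms
    by (intro set_integrable_mult_right set_integral_add integrable_Beta) (auto simp: \<gamma>_def)
  then have "set_integrable lborel {0<..<1} h"
    by (rule set_integrable_subset) auto
  then show ?thesis
  proof (rule set_integrable_bound)
    show "set_borel_measurable lborel {0<..<1} (lambda_integrand p r \<beta>)"
      using set_measurable_continuous_on[OF _ continuous_on_lambda_integrand[OF assms(1)]]
      by (simp add: set_borel_measurable_def)
    show "AE t in lborel. t \<in> {0<..<1} \<longrightarrow> norm (lambda_integrand p r \<beta> t) \<le> norm (h t)"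
    proof (intro AE_I2 impI)
      fix t :: real assume "t \<in> {0<..<1}"
      then have t: "0 < t" "t < 1" by auto
      define a where "a = t powr \<beta>"
      have "0 < a" using t by (simp add: a_def)
      have "\<bar>1 - a\<bar> powr (p - 1) \<le> (2 * (1 + \<bar>\<beta>\<bar>) * ((1 - t) * (1 + a))) powr (p - 1)"
        unfolding a_def using t assms abs_one_minus_powr_le[OF t] by (intro powr_mono2) auto
      also have "\<dots> = (2 * (1 + \<bar>\<beta>\<bar>)) powr (p - 1) * ((1 - t) powr (p - 1) * (1 + a) powr (p - 1))"
        by (simp only: powr_mult)
      also have "\<dots> \<le> (2 * (1 + \<bar>\<beta>\<bar>)) powr (p - 1)
          * ((1 - t) powr (p - 1) * (2 powr (p - 1) * (1 + a powr (p - 1))))"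
        using assms \<open>0 < a\<close> by (intro mult_left_mono powr_one_plus_le) auto
      finally have J: "\<bar>J p (1 - a)\<bar> \<le> \<dots>"
        using assms by (simp add: abs_J)
      have "\<bar>lambda_integrand p r \<beta> t\<bar>
          = \<bar>J p (1 - a)\<bar> * \<bar>1 - t powr \<gamma>\<bar> / (1 - t) powr (1 + r)"
        by (simp add: lambda_integrand_def a_def \<gamma>_def abs_mult)
      also have "\<dots> \<le> ((2 * (1 + \<bar>\<beta>\<bar>)) powr (p - 1)
          * ((1 - t) powr (p - 1) * (2 powr (p - 1) * (1 + a powr (p - 1)))))
          * (2 * (1 + \<bar>\<gamma>\<bar>) * ((1 - t) * (1 + t powr \<gamma>))) / (1 - t) powr (1 + r)"
        using t by (intro divide_right_mono mult_mono J abs_one_minus_powr_le) auto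
      also have "\<dots> = K * ((1 + a powr (p - 1)) * (1 + t powr \<gamma>))
          * ((1 - t) powr (p - 1) * (1 - t) / (1 - t) powr (1 + r))"
        by (simp add: K_def)
      also have "(1 - t) powr (p - 1) * (1 - t) / (1 - t) powr (1 + r) = (1 - t) powr (p - r - 1)"
      proof -
        have "(1 - t) powr (p - 1) * (1 - t) = (1 - t) powr p"
          using t powr_add[of "1 - t" "p - 1" 1] by simp
        moreover have "p - (1 + r) = p - r - 1" by simp
        ultimately show ?thesis by (metis powr_diff)
      qed
      also have "(1 + a powr (p - 1)) * (1 + t powr \<gamma>)
          = 1 + t powr (\<beta> * (p - 1)) + t powr \<gamma> + t powr (r - 1)"
        by (simp add: a_def \<gamma>_def powr_powr algebra_simps flip: powr_add)
      also have "K * \<dots> * (1 - t) powr (p - r - 1) = h t"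
        using t by (simp add: h_def algebra_simps)
      finally show "norm (lambda_integrand p r \<beta> t) \<le> norm (h t)"
        by simp
    qed
  qed
qed

section \<open>Monotonicity and continuity of the integral\<close>

lemma set_lebesgue_integral_strict_mono:
  fixes f g :: "real \<Rightarrow> real"
  assumes f: "set_integrable lborel {0<..<1} f" and g: "set_integrable lborel {0<..<1} g"
    and less: "\<And>t. 0 < t \<Longrightarrow> t < 1 \<Longrightarrow> f t < g t"
  shows "(LINT t:{0<..<1}|lborel. f t) < (LINT t:{0<..<1}|lborel. g t)"
proof -
  have "(LINT t:{0<..<1}|lborel. f t) \<le> (LINT t:{0<..<1}|lborel. g t)"
    using f g less by (intro set_integral_mono) (auto intro: less_imp_le)
  moreover have "(LINT t:{0<..<1}|lborel. g t - f t) \<noteq> 0"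
  proof
    assume "(LINT t:{0<..<1}|lborel. g t - f t) = 0"
    then have "{0<..<1::real} \<in> null_sets lborel"
      using set_integral_diff(1)[OF g f] less
      by (intro null_if_pos_func_has_zero_int[where
            f = "\<lambda>t. indicator {0<..<1} t *\<^sub>R (g t - f t)"])
        (auto simp: set_integrable_def set_lebesgue_integral_def simp flip: mult.assoc indicator_inter_arith)
    then show False by (simp add: null_sets_def)
  qed
  ultimately show ?thesis using f g by simp
qed

lemma LINT_powr_from_0:
  fixes e \<delta> :: real
  assumes "0 < e" and "0 < \<delta>" and "\<delta> < 1"
  shows "set_integrable lborel {0..\<delta>} (\<lambda>t. t powr (e - 1))"
    and "(LINT t:{0..\<delta>}|lborel. t powr (e - 1)) = \<delta> powr e / e"
proof -
  have "set_integrable lborel {0..\<delta>} (\<lambda>t. t powr (e - 1) * (1 - t) powr (1 - 1))"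
    by (rule set_integrable_subset[OF integrable_Beta]) (use assms in auto)
  moreover have "set_integrable lborel {0..\<delta>} (\<lambda>t. t powr (e - 1) * (1 - t) powr (1 - 1))
      = set_integrable lborel {0..\<delta>} (\<lambda>t. t powr (e - 1))"
    by (intro set_integrable_cong) (use assms in auto)
  ultimately show *: "set_integrable lborel {0..\<delta>} (\<lambda>t. t powr (e - 1))" by simp
  show "(LINT t:{0..\<delta>}|lborel. t powr (e - 1)) = \<delta> powr e / e"
    using set_borel_integral_eq_integral(2)[OF *] has_integral_powr_from_0[of "e - 1" \<delta>] assms
    by (auto dest: integral_unique)
qed

lemma admissible_parameter_bounds:
  fixes p r \<beta> :: real
  assumes "1 < p" and "- 1 / (p - 1) < \<beta>" and "\<beta> < r / (p - 1)"
  shows "- 1 < \<beta> * (p - 1)" and "\<beta> * (p - 1) < r"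
  using assms by (auto simp: field_simps)

lemma lambda_strictly_unimodal:
  assumes "1 < p" and "0 < s" and "s < 1"
    and "- 1 / (p - 1) < \<beta>" and "\<beta> < \<gamma>" and "\<gamma> < s * p / (p - 1)"
  shows "\<gamma> \<le> (s * p - 1) / p \<Longrightarrow> lambda s p \<beta> < lambda s p \<gamma>"
    and "(s * p - 1) / p \<le> \<beta> \<Longrightarrow> lambda s p \<gamma> < lambda s p \<beta>"
proof -
  have "0 < s * p" "s * p < p" using assms by auto
  moreover have "- 1 < \<beta> * (p - 1)" "\<beta> * (p - 1) < s * p" "- 1 < \<gamma> * (p - 1)" "\<gamma> * (p - 1) < s * p"
    using admissible_parameter_bounds[of p \<beta> "s * p"] admissible_parameter_bounds[of p \<gamma> "s * p"] assms by auto
  ultimately have int: "set_integrable lborel {0<..<1} (lambda_integrand p (s * p) \<beta>)"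
    "set_integrable lborel {0<..<1} (lambda_integrand p (s * p) \<gamma>)"
    using assms by (auto intro!: lambda_integrand_integrable)
  show "\<gamma> \<le> (s * p - 1) / p \<Longrightarrow> lambda s p \<beta> < lambda s p \<gamma>"
    unfolding lambda_eq using assms
    by (auto intro!: set_lebesgue_integral_strict_mono int lambda_integrand_strict_mono)
  show "(s * p - 1) / p \<le> \<beta> \<Longrightarrow> lambda s p \<gamma> < lambda s p \<beta>"
    unfolding lambda_eq using assms
    by (auto intro!: set_lebesgue_integral_strict_mono int lambda_integrand_strict_antimono)
qed

text \<open>Dominated convergence: left of the peak the integrand is monotone in the parameter, so on
  \<open>[\<alpha>, \<gamma>]\<close> it lies between its values at the two ends, and the sum of their absolute values
  dominates.\<close>

lemma continuous_on_lambda: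
  assumes "1 < p" and "0 < s" and "s < 1"
    and "- 1 / (p - 1) < \<alpha>" and "\<gamma> \<le> (s * p - 1) / p" and "\<gamma> < s * p / (p - 1)"
  shows "continuous_on {\<alpha>..\<gamma>} (lambda s p)"
proof (cases "\<alpha> \<le> \<gamma>")
  case True
  let ?g = "lambda_integrand p (s * p)"
  have int: "set_integrable lborel {0<..<1} (?g \<beta>)" if "\<beta> \<in> {\<alpha>..\<gamma>}" for \<beta>
  proof -
    have "- 1 < \<beta> * (p - 1)" "\<beta> * (p - 1) < s * p"
      using admissible_parameter_bounds[of p \<beta> "s * p"] assms that by auto
    then show ?thesis using assms by (intro lambda_integrand_integrable) auto
  qed
  have le: "?g \<beta> t \<le> ?g \<beta>' t" if "\<alpha> \<le> \<beta>" "\<beta> \<le> \<beta>'" "\<beta>' \<le> \<gamma>" "0 < t" "t < 1" for \<beta> \<beta>' t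
  proof (cases "\<beta> = \<beta>'")
    case False
    then show ?thesis
      using lambda_integrand_strict_mono[of p t \<beta> \<beta>' "s * p"] that assms by auto
  qed simp
  have "continuous_on {\<alpha>..\<gamma>} (\<lambda>\<beta>. LINT t:{0<..<1}|lborel. ?g \<beta> t)"
    unfolding continuous_on_sequentially
  proof (intro allI impI ballI, unfold comp_def)
    fix X :: "nat \<Rightarrow> real" and \<beta> assume \<beta>: "\<beta> \<in> {\<alpha>..\<gamma>}" and X: "(\<forall>n. X n \<in> {\<alpha>..\<gamma>}) \<and> X \<longlonglongrightarrow> \<beta>"
    have lim: "(\<lambda>n. ?g (X n) t) \<longlonglongrightarrow> ?g \<beta> t" if "0 < t" "t < 1" for t
      using continuous_on_lambda_integrand_parameter[of p t "{\<alpha>..\<gamma>}" "s * p"] that assms X \<beta>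
      unfolding continuous_on_sequentially comp_def by blast
    show "(\<lambda>n. LINT t:{0<..<1}|lborel. ?g (X n) t) \<longlonglongrightarrow> (LINT t:{0<..<1}|lborel. ?g \<beta> t)"
      unfolding set_lebesgue_integral_def
    proof (rule integral_dominated_convergence)
      show "integrable lborel (\<lambda>t. indicator {0<..<1} t *\<^sub>R (\<bar>?g \<alpha> t\<bar> + \<bar>?g \<gamma> t\<bar>))"
        using set_integral_add(1)[OF set_integrable_abs[OF int] set_integrable_abs[OF int], of \<alpha> \<gamma>] True
        by (simp add: set_integrable_def)
      show "(\<lambda>t. indicator {0<..<1} t *\<^sub>R ?g \<beta> t) \<in> borel_measurable lborel"
        using int[OF \<beta>] by (simp add: set_integrable_def)
      show "(\<lambda>t. indicator {0<..<1} t *\<^sub>R ?g (X n) t) \<in> borel_measurable lborel" for n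
        using int[of "X n"] X by (simp add: set_integrable_def)
      show "AE t in lborel. (\<lambda>n. indicator {0<..<1} t *\<^sub>R ?g (X n) t)
          \<longlonglongrightarrow> indicator {0<..<1} t *\<^sub>R ?g \<beta> t"
        using lim by (auto simp: indicator_def)
      show "AE t in lborel. norm (indicator {0<..<1} t *\<^sub>R ?g (X n) t)
          \<le> indicator {0<..<1} t *\<^sub>R (\<bar>?g \<alpha> t\<bar> + \<bar>?g \<gamma> t\<bar>)" for n
      proof (intro AE_I2)
        fix t
        show "norm (indicator {0<..<1} t *\<^sub>R ?g (X n) t)
          \<le> indicator {0<..<1} t *\<^sub>R (\<bar>?g \<alpha> t\<bar> + \<bar>?g \<gamma> t\<bar>)"
          using le[of \<alpha> "X n" t] le[of "X n" \<gamma> t] X by (auto simp: indicator_def)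
      qed
    qed
  qed
  then show ?thesis
    unfolding lambda_eq[abs_def] by (intro continuous_intros)
qed simp

section \<open>Maximum and zeros\<close>

lemma lambda_at_maximum:
  assumes "1 < p"
  shows "lambda s p ((s * p - 1) / p) =
    2 * (LINT t:{0<..<1}|lborel. \<bar>1 - t powr ((s * p - 1) / p)\<bar> powr p / (1 - t) powr (1 + s * p))
    + 2 / (s * p)"
proof -
  have "s * p - 1 - (s * p - 1) / p * (p - 1) = (s * p - 1) / p"
    using assms by (simp add: field_simps)
  then show ?thesis
    unfolding lambda_def by (simp add: J_mult_self)
qed

text \<open>For \<open>\<beta> = s\<close> the second exponent is \<open>s - 1\<close>, and the integrand has the primitive \<open>G / r\<close> with
  \<open>G t = (1 - t powr s) powr p * (1 - t) powr (- r)\<close>. At \<open>t = 1\<close> the first factor of \<open>G\<close> vanishes to order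
  \<open>p\<close> and wins against \<open>r = s * p < p\<close>.\<close>

lemma lambda_s_eq_0:
  assumes "1 < p" and "0 < s" and "s < 1"
  shows "lambda s p s = 0"
proof -
  define r where "r = s * p"
  have r: "0 < r" "r < p" using assms by (auto simp: r_def)
  define G where "G t = (1 - t powr s) powr p * (1 - t) powr (- r)" for t :: real
  have powr_less_1: "t powr s < 1" if "0 < t" "t < 1" for t :: real
    using that assms powr_less_mono2[of s t 1] by simp
  have deriv: "(G has_real_derivative r * lambda_integrand p r s t) (at t)" if t: "0 < t" "t < 1" for t
  proof -
    note le = powr_less_1[OF t]
    have "(G has_real_derivative
        (p * (1 - t powr s) powr (p - 1) * - (s * t powr (s - 1))) * (1 - t) powr (- r)
        + (r * (1 - t) powr (- r - 1)) * (1 - t powr s) powr p) (at t)"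
      unfolding G_def[abs_def] using t le by (auto intro!: derivative_eq_intros)
    also have "(1 - t powr s) powr p = (1 - t powr s) powr (p - 1) * (1 - t powr s)"
      using le powr_add[of "1 - t powr s" "p - 1" 1] by simp
    also have "(1 - t) powr (- r) = (1 - t) powr (- r - 1) * (1 - t)"
      using t powr_add[of "1 - t" "- r - 1" 1] by simp
    also have "t powr s = t powr (s - 1) * t"
      using t powr_add[of t "s - 1" 1] by simp
    finally have *: "(G has_real_derivative r * ((1 - t powr s) powr (p - 1) * (1 - t) powr (- r - 1)
        * (1 - t powr (s - 1)))) (at t)"
      using powr_add[of t "s - 1" 1] t by (simp add: r_def algebra_simps)
    have "lambda_integrand p r s t = (1 - t powr s) powr (p - 1) * (1 - t) powr (- r - 1)
        * (1 - t powr (s - 1))"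
    proof -
      have "(1 - t) powr (- r - 1) = 1 / (1 - t) powr (1 + r)"
        proof -
        have "- r - 1 = - (1 + r)" by simp
        then show ?thesis by (simp only: powr_minus_divide)
      qed
      moreover have "r - 1 - s * (p - 1) = s - 1"
        by (simp add: r_def algebra_simps)
      ultimately show ?thesis
        using le unfolding lambda_integrand_def by (simp only:) (simp add: J_eq_sgn)
    qed
    with * show ?thesis by simp
  qed
  have int: "set_integrable lborel {0<..<1} (lambda_integrand p r s)"
  proof (rule lambda_integrand_integrable)
    have "0 < s * (p - 1)" using assms by simp
    then show "- 1 < s * (p - 1)" by linarith
    show "s * (p - 1) < r" using assms by (simp add: r_def)
  qed (use assms r in auto)
  have cont: "isCont (lambda_integrand p r s) t" if "0 < t" "t < 1" for t
    using continuous_on_lambda_integrand[of p r s] that assms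
    by (simp add: continuous_on_eq_continuous_at)
  have lim0: "(G \<longlongrightarrow> 1) (at_right 0)"
  proof -
    have "(G \<longlongrightarrow> (1 - 0 powr s) powr p * (1 - 0) powr (- r)) (at_right 0)"
      unfolding G_def using assms
      by (intro tendsto_intros tendsto_powr') (auto intro: eventually_mono[OF eventually_at_right_less])
    then show ?thesis by simp
  qed
  define C where "C = (4 * (1 + s)) powr p"
  have lim1: "(G \<longlongrightarrow> 0) (at_left 1)"
  proof (rule tendsto_sandwich[where f = "\<lambda>_. 0" and h = "\<lambda>t. C * (1 - t) powr (p - r)"])
    have "((\<lambda>t. C * (1 - t) powr (p - r)) \<longlongrightarrow> C * (1 - 1) powr (p - r)) (at_left 1)"
      using r by (intro tendsto_intros tendsto_powr')
        (auto simp: eventually_at_left_field intro: exI[of _ 0])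
    then show "((\<lambda>t. C * (1 - t) powr (p - r)) \<longlongrightarrow> 0) (at_left 1)" using r by simp
    show "\<forall>\<^sub>F t in at_left 1. 0 \<le> G t" by (simp add: G_def)
    have "G t \<le> C * (1 - t) powr (p - r)" if t: "0 < t" "t < 1" for t
    proof -
      note le = powr_less_1[OF t]
      have "1 - t powr s \<le> 2 * (1 + s) * ((1 - t) * (1 + t powr s))"
        using abs_one_minus_powr_le[OF t, of s] assms by simp
      also have "\<dots> \<le> 2 * (1 + s) * ((1 - t) * 2)"
        using assms t le by (intro mult_left_mono) auto
      finally have "(1 - t powr s) powr p \<le> (4 * (1 + s) * (1 - t)) powr p"
        using le assms by (intro powr_mono2) (auto simp: algebra_simps)
      also have "\<dots> = C * (1 - t) powr p" by (simp only: C_def powr_mult)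
      finally have "G t \<le> (C * (1 - t) powr p) * (1 - t) powr (- r)"
        unfolding G_def by (intro mult_right_mono) auto
      then show ?thesis by (simp add: powr_diff powr_minus_divide)
    qed
    then show "\<forall>\<^sub>F t in at_left 1. G t \<le> C * (1 - t) powr (p - r)"
      by (auto simp: eventually_at_left_field intro: exI[of _ 0])
  qed simp
  have "(LBINT t=0..1. r * lambda_integrand p r s t) = 0 - 1"
  proof (rule interval_integral_FTC_integrable)
    show "set_integrable lborel (einterval 0 1) (\<lambda>t. r * lambda_integrand p r s t)"
      using int by (simp add: einterval_eq zero_ereal_def one_ereal_def)
  qed (use deriv cont lim0 lim1 in \<open>auto simp: has_real_derivative_iff_has_vector_derivative[symmetric]
      ereal_tendsto_simps zero_ereal_def one_ereal_def intro!: continuous_intros\<close>)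
  then have "r * (LINT t:{0<..<1}|lborel. lambda_integrand p r s t) = - 1"
    by (simp add: interval_lebesgue_integral_def zero_ereal_def one_ereal_def einterval_eq)
  then have "(LINT t:{0<..<1}|lborel. lambda_integrand p r s t) = - 1 / r"
    using r by (simp add: field_simps)
  then show ?thesis by (simp add: lambda_eq r_def)
qed


text \<open>Let \<open>\<beta> * (p - 1) = e - 1\<close> with small \<open>e > 0\<close>. On a fixed interval \<open>(0, \<delta>]\<close> the integrand is at
  most \<open>- C * t powr (e - 1)\<close> with \<open>C\<close> independent of \<open>e\<close>, and it is nonpositive elsewhere. Its
  integral is thus at most \<open>- C * \<delta> powr e / e \<le> - C * \<delta> / e\<close>, which beats the constant \<open>2 / r\<close>
  once \<open>e\<close> is small.\<close>

lemma lambda_negative_near_left_end: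
  assumes "1 < p" and "0 < s" and "s < 1"
  obtains \<beta> where "- 1 / (p - 1) < \<beta>" and "\<beta> < (s * p - 1) / p" and "lambda s p \<beta> < 0"
proof -
  define r where "r = s * p"
  have r: "0 < r" "r < p" using assms by (auto simp: r_def)
  \<comment> \<open>Since \<open>e \<le> 1 / 2\<close> gives \<open>\<beta> \<le> - 1 / (2 * (p - 1))\<close>, this \<open>\<delta>\<close> ensures \<open>t powr \<beta> \<ge> 2\<close> on
    \<open>(0, \<delta>]\<close>.\<close>
  define \<delta> where "\<delta> = (2::real) powr (- 2 * (p - 1))"
  have \<delta>: "0 < \<delta>" "\<delta> < 1"
    unfolding \<delta>_def using powr_less_mono[of "- 2 * (p - 1)" 0 "2::real"] assms by auto
  \<comment> \<open>The first factor comes from \<open>t powr \<beta> - 1 \<ge> t powr \<beta> / 2\<close>, the second from the exponent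
    \<open>r - e \<ge> r / 2\<close>.\<close>
  define C where "C = 2 powr (1 - p) * (1 - \<delta> powr (r / 2))"
  have "\<delta> powr (r / 2) < 1" using powr_less_mono2[of "r / 2" \<delta> 1] \<delta> r by simp
  then have "0 < C" by (simp add: C_def)
  define e where "e = min (min (1 / 2) (r / 2)) (C * \<delta> * r / 2)"
  have e: "0 < e" "e \<le> 1 / 2" "e \<le> r / 2" "e \<le> C * \<delta> * r / 2"
    using r \<delta> \<open>0 < C\<close> by (auto simp: e_def)
  define \<beta> where "\<beta> = (e - 1) / (p - 1)"
  have \<beta>: "\<beta> * (p - 1) = e - 1" using assms by (simp add: \<beta>_def)
  have "\<beta> < (r - 1) / p"
  proof -
    have "e * (p - 1) \<le> r / 2 * (p - 1)" using e assms by (intro mult_right_mono) auto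
    moreover have "0 < r * (p - 1)" using r assms by simp
    moreover have "(e - 1) * p = e * (p - 1) + e - p" "(r - 1) * (p - 1) = r * (p - 1) - p + 1"
      by (simp_all add: algebra_simps)
    ultimately have "(e - 1) * p < (r - 1) * (p - 1)" using e by linarith
    then show ?thesis using assms by (simp add: \<beta>_def field_simps)
  qed
  moreover have "- 1 / (p - 1) < \<beta>"
    unfolding \<beta>_def using e assms by (intro divide_strict_right_mono) auto
  moreover have "lambda s p \<beta> < 0"
  proof -
    have neg: "lambda_integrand p r \<beta> t
        = - ((t powr \<beta> - 1) powr (p - 1) / (1 - t) powr (1 + r) * (1 - t powr (r - e)))"
      and ge: "1 < t powr \<beta>" if t: "0 < t" "t < 1" for t
    proof -
      have "\<beta> < 0" using e assms by (auto simp: \<beta>_def field_simps)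
      then show "1 < t powr \<beta>" using powr_less_mono'[of t \<beta> 0] t by simp
      then show "lambda_integrand p r \<beta> t
        = - ((t powr \<beta> - 1) powr (p - 1) / (1 - t) powr (1 + r) * (1 - t powr (r - e)))"
      proof -
        have "r - 1 - \<beta> * (p - 1) = r - e" using \<beta> by simp
        with \<open>1 < t powr \<beta>\<close> show ?thesis
          unfolding lambda_integrand_def by (simp only:) (simp add: J_eq_sgn)
      qed
    qed
    have bound: "lambda_integrand p r \<beta> t \<le> - C * t powr (e - 1)" if t: "0 < t" "t \<le> \<delta>" for t
    proof -
      have "t < 1" using t \<delta> by simp
      have "2 = \<delta> powr (- 1 / (2 * (p - 1)))"
      proof -
        have "- 2 * (p - 1) * (- 1 / (2 * (p - 1))) = 1" using assms by (simp add: field_simps)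
        then show ?thesis unfolding \<delta>_def powr_powr by simp
      qed
      also have "\<dots> \<le> t powr (- 1 / (2 * (p - 1)))"
        using t assms by (intro powr_mono2') auto
      also have "\<dots> \<le> t powr \<beta>"
      proof -
        have "\<beta> \<le> (- 1 / 2) / (p - 1)"
          unfolding \<beta>_def using e assms by (intro divide_right_mono) auto
        then show ?thesis using t \<open>t < 1\<close> by (intro powr_mono') auto
      qed
      finally have "t powr \<beta> / 2 \<le> t powr \<beta> - 1" by simp
      then have "(t powr \<beta> / 2) powr (p - 1) \<le> (t powr \<beta> - 1) powr (p - 1)"
        using assms by (intro powr_mono2) auto
      also have "(t powr \<beta> / 2) powr (p - 1) = 2 powr (1 - p) * t powr (e - 1)"
        using powr_minus_divide[of 2 "p - 1"] by (simp add: powr_divide powr_powr \<beta>)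
      finally have 1: "2 powr (1 - p) * t powr (e - 1) \<le> (t powr \<beta> - 1) powr (p - 1)" .
      have "(1 - t) powr (1 + r) \<le> 1"
        using t \<open>t < 1\<close> r by (intro powr_le1) auto
      then have "(t powr \<beta> - 1) powr (p - 1) * 1
          \<le> (t powr \<beta> - 1) powr (p - 1) * (1 / (1 - t) powr (1 + r))"
        using \<open>t < 1\<close> by (intro mult_left_mono) auto
      with 1 have 2: "2 powr (1 - p) * t powr (e - 1)
          \<le> (t powr \<beta> - 1) powr (p - 1) / (1 - t) powr (1 + r)"
        by simp
      have "t powr (r - e) \<le> t powr (r / 2)"
        using t \<open>t < 1\<close> e by (intro powr_mono') auto
      also have "\<dots> \<le> \<delta> powr (r / 2)"
        using t r by (intro powr_mono2) auto
      finally have 3: "1 - \<delta> powr (r / 2) \<le> 1 - t powr (r - e)" by simp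
      have "2 powr (1 - p) * t powr (e - 1) * (1 - \<delta> powr (r / 2))
          \<le> (t powr \<beta> - 1) powr (p - 1) / (1 - t) powr (1 + r) * (1 - t powr (r - e))"
        using 2 3 \<open>\<delta> powr (r / 2) < 1\<close> by (intro mult_mono) auto
      then show ?thesis
        using neg[of t] t \<open>t < 1\<close> by (simp add: C_def algebra_simps)
    qed
    have nonpos: "lambda_integrand p r \<beta> t \<le> 0" if t: "0 < t" "t < 1" for t
    proof -
      have "t powr (r - e) \<le> 1" using t e by (intro powr_le1) auto
      then show ?thesis using neg[OF t] t by (auto intro!: mult_nonneg_nonneg divide_nonneg_nonneg)
    qed
    have int: "set_integrable lborel {0<..<1} (lambda_integrand p r \<beta>)"
      using assms r e by (intro lambda_integrand_integrable) (auto simp: \<beta>)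
    have "(LINT t:{0<..<1}|lborel. lambda_integrand p r \<beta> t)
        \<le> (LINT t:{0..\<delta>}|lborel. - C * t powr (e - 1))"
      unfolding set_lebesgue_integral_def
    proof (rule integral_mono)
      show "integrable lborel (\<lambda>t. indicator {0<..<1} t *\<^sub>R lambda_integrand p r \<beta> t)"
        using int by (simp add: set_integrable_def)
      show "integrable lborel (\<lambda>t. indicator {0..\<delta>} t *\<^sub>R (- C * t powr (e - 1)))"
        using set_integrable_mult_right[OF LINT_powr_from_0(1)[OF e(1) \<delta>], of "- C"]
        by (simp add: set_integrable_def)
      show "indicator {0<..<1} t *\<^sub>R lambda_integrand p r \<beta> t
          \<le> indicator {0..\<delta>} t *\<^sub>R (- C * t powr (e - 1))" for t
        using bound[of t] nonpos[of t] \<delta> by (auto simp: indicator_def)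
    qed
    also have "\<dots> = - C * (\<delta> powr e / e)"
      by (simp only: set_integral_mult_right LINT_powr_from_0(2)[OF e(1) \<delta>])
    also have "\<dots> \<le> - C * (\<delta> / e)"
    proof -
      have "\<delta> \<le> \<delta> powr e" using powr_mono'[of e 1 \<delta>] \<delta> e by simp
      then show ?thesis using \<open>0 < C\<close> e by (simp add: divide_right_mono)
    qed
    also have "\<dots> \<le> - 2 / r"
    proof -
      have "2 * e \<le> C * \<delta> * r" using e by simp
      then show ?thesis using e r by (simp add: field_simps)
    qed
    also have "\<dots> < - 1 / r" using r by (simp add: field_simps)
    finally have "2 * (LINT t:{0<..<1}|lborel. lambda_integrand p r \<beta> t) < 2 * (- 1 / r)"
      by simp
    then show ?thesis by (simp add: lambda_eq r_def)
  qed
  ultimately show thesis using that by (simp add: r_def)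
qed

theorem proposition4p4:
  fixes p s :: real
  assumes "1 < p" and "0 < s" and "s < 1"
  shows "strict_antimono_on {(s * p - 1) / p<..<s * p / (p - 1)} (lambda s p)
    \<and> strict_mono_on {- 1 / (p - 1)<..<(s * p - 1) / p} (lambda s p)
    \<and> (\<forall>\<beta>\<in>{- 1 / (p - 1)<..<s * p / (p - 1)}. lambda s p \<beta> \<le> lambda s p ((s * p - 1) / p))
    \<and> lambda s p ((s * p - 1) / p) =
        2 * (LINT t:{0<..<1}|lborel.
               \<bar>1 - t powr ((s * p - 1) / p)\<bar> powr p / (1 - t) powr (1 + s * p))
        + 2 / (s * p)
    \<and> (\<exists>\<beta>'. - 1 / (p - 1) < \<beta>' \<and> \<beta>' < (s * p - 1) / p
          \<and> lambda s p \<beta>' = 0 \<and> lambda s p s = 0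
          \<and> (\<forall>\<beta>\<in>{- 1 / (p - 1)<..<s * p / (p - 1)}.
                0 \<le> lambda s p \<beta> \<longleftrightarrow> \<beta>' \<le> \<beta> \<and> \<beta> \<le> s))"
proof -
  define m where "m = (s * p - 1) / p"
  define lo where "lo = - 1 / (p - 1)"
  define hi where "hi = s * p / (p - 1)"
  have "0 < s * p" using assms by simp
  \<comment> \<open>With denominators cleared, \<open>lo < m\<close> and \<open>m < hi\<close> read \<open>p * s < 1 + p * (p * s)\<close> and \<open>1 < p + p * s\<close>.\<close>
  have "p * s < p * (p * s)" using assms by simp
  then have "p * s < 1 + p * (p * s)" by linarith
  then have "lo < m" "m < hi"
    using assms add_strict_mono[of 1 p 0 "p * s"]
    by (auto simp: lo_def hi_def m_def field_simps)
  have "m < s" "s < hi"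
    using assms by (auto simp: hi_def m_def field_simps)
  have inc: "lambda s p \<beta> < lambda s p \<gamma>" if "lo < \<beta>" "\<beta> < \<gamma>" "\<gamma> \<le> m" for \<beta> \<gamma>
    using lambda_strictly_unimodal(1)[of p s \<beta> \<gamma>] that assms \<open>m < hi\<close>
    unfolding m_def lo_def hi_def by linarith
  have dec: "lambda s p \<gamma> < lambda s p \<beta>" if "m \<le> \<beta>" "\<beta> < \<gamma>" "\<gamma> < hi" for \<beta> \<gamma>
    using lambda_strictly_unimodal(2)[of p s \<beta> \<gamma>] that assms \<open>lo < m\<close>
    unfolding m_def lo_def hi_def by linarith
  have zero: "lambda s p s = 0" using assms by (rule lambda_s_eq_0)
  have "0 < lambda s p m" using dec[of m s] \<open>m < s\<close> \<open>s < hi\<close> zero by simp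
  obtain \<alpha> where \<alpha>: "lo < \<alpha>" "\<alpha> < m" "lambda s p \<alpha> < 0"
    using lambda_negative_near_left_end[OF assms] unfolding lo_def m_def by blast
  have "\<exists>\<beta>'\<ge>\<alpha>. \<beta>' \<le> m \<and> lambda s p \<beta>' = 0"
  proof (rule IVT')
    show "continuous_on {\<alpha>..m} (lambda s p)"
      using assms \<alpha> \<open>m < hi\<close> unfolding lo_def m_def hi_def by (intro continuous_on_lambda) auto
  qed (use \<alpha> \<open>0 < lambda s p m\<close> in auto)
  then obtain \<beta>' where \<beta>': "\<alpha> \<le> \<beta>'" "\<beta>' \<le> m" "lambda s p \<beta>' = 0" by blast
  with \<open>0 < lambda s p m\<close> have "\<beta>' < m" by (cases "\<beta>' = m") auto
  have max: "lambda s p \<beta> \<le> lambda s p m" if "lo < \<beta>" "\<beta> < hi" for \<beta>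
    using inc[of \<beta> m] dec[of m \<beta>] that by (cases \<beta> m rule: linorder_cases) auto
  have sign: "0 \<le> lambda s p \<beta> \<longleftrightarrow> \<beta>' \<le> \<beta> \<and> \<beta> \<le> s" if "lo < \<beta>" "\<beta> < hi" for \<beta>
  proof (cases "\<beta> \<le> m")
    case True
    then show ?thesis
      using inc[of \<beta> \<beta>'] inc[of \<beta>' \<beta>] that \<alpha> \<beta>' \<open>m < s\<close>
      by (cases \<beta> \<beta>' rule: linorder_cases) auto
  next
    case False
    then show ?thesis
      using dec[of \<beta> s] dec[of s \<beta>] that \<beta>' \<open>m < s\<close> \<open>s < hi\<close> zero
      by (cases \<beta> s rule: linorder_cases) auto
  qed
  have "strict_antimono_on {m<..<hi} (lambda s p)"
    by (auto intro!: monotone_onI dec)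
  moreover have "strict_mono_on {lo<..<m} (lambda s p)"
    by (auto intro!: monotone_onI inc)
  moreover have "lo < \<beta>'" using \<alpha> \<beta>' by simp
  ultimately show ?thesis
    using max sign zero \<open>\<beta>' < m\<close> \<beta>' lambda_at_maximum[OF assms(1), of s]
    unfolding m_def lo_def hi_def by (intro conjI exI[of _ \<beta>']) auto
qed

end
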